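(* In an episodic tabular MDP with one-step reward lookahead, the optimal value of one-step reward lookahead agents satisfies $$V^{R,*}_{H+1}(s)=0\quad\forall s\in\mathcal S,$$ $$V^{R,*}_h(s)=\mathbb E_{\boldsymbol R\sim\mathcal R_h(s)}\Big[\max_{a\in\mathcal A}\Big\{R(a)+\sum_{s'\in\mathcal S}P_h(s'\mid s,a)V^{R,*}_{h+1}(s')\Big\}\Big]\quad\forall s\in\mathcal S,\ h\in[H].$$ Moreover, given reward observations $\boldsymbol R=\{R(a)\}_{a\in\mathcal A}$ at state $s$ and step $h$, the optimal policy is $$\pi^*_h(s,\boldsymbol R)\in\arg\max_{a\in\mathcal A}\Big\{R(a)+\sum_{s'\in\mathcal S}P_h(s'\mid s,a)V^{R,*}_{h+1}(s')\Big\}.$$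
   Context: An episodic tabular MDP $\mathcal M=(\mathcal S,\mathcal A,H,P,\mathcal R)$ has finite state space $\mathcal S$, finite action space $\mathcal A$ ($|\mathcal A|=A$), horizon $H\in\mathbb N$ ($[H]=\{1,\dots,H\}$), transition kernels $P_h(\cdot\mid s,a)$, and for each $(h,s)$ a joint reward distribution $\mathcal R_h(s)$ on $[0,1]^{\mathcal A}$ (coordinates for different actions may be dependent). One-step reward lookahead: at step $h$ in state $s_h$, the whole reward vector $\boldsymbol R_h=\{R_h(s_h,a)\}_{a\in\mathcal A}\sim\mathcal R_h(s_h)$ is drawn (independently of the past given $s_h$) and observed; the agent then picks $a_h$, collects $R_h(s_h,a_h)$, and $s_{h+1}\sim P_h(\cdot\mid s_h,a_h)$ is drawn independently of everything else given $(s_h,a_h)$. Policies: $\Pi^R=\{\pi:[H]\times\mathcal S\times[0,1]^A\to\Delta_{\mathcal A}\}$ ($\Delta_{\mathcal A}$ the probability simplex), with $a_h=\pi_h(s_h,\boldsymbol R_h)$. Value: $V_h^{R,\pi}(s)=\mathbb E[\sum_{t=h}^HR_t(s_t,\pi_t(s_t,\boldsymbol R_t(s_t)))\mid s_h=s]$, and $V^{R,*}_h(s)=\max_{\pi\in\Pi^R}V^{R,\pi}_h(s)$. A policy is optimal if it attains $V_h^{R,*}(s)$ for all $h,s$. *)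

theory Defs
  imports "HOL-Probability.Probability"
begin

record ('s, 'a) mdp =
  horizon :: nat
  transition :: "nat \<Rightarrow> 's \<Rightarrow> 'a \<Rightarrow> 's pmf"
  rewards :: "nat \<Rightarrow> 's \<Rightarrow> ('a \<Rightarrow> real) measure"

text \<open>The cube \<open>[0,1]\<^sup>A\<close> with its product Borel sigma-algebra. The joint law of the reward
  vector is an arbitrary probability measure on it, so coordinates may be dependent.\<close>

definition reward_space :: "('a \<Rightarrow> real) measure" where
  "reward_space = PiM UNIV (\<lambda>_. restrict_space borel {0..1})"

definition episodic_mdp :: "('s::finite, 'a::finite) mdp \<Rightarrow> bool" where
  "episodic_mdp M \<longleftrightarrow>
     (\<forall>h\<in>{1..horizon M}. \<forall>s. rewards M h s \<in> space (prob_algebra reward_space))"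

text \<open>The simplex over a finite action type is the type of pmfs on it. Policies must be measurable
  in the observed rewards, as otherwise the expected return is not defined.\<close>

type_synonym ('s, 'a) policy = "nat \<Rightarrow> 's \<Rightarrow> ('a \<Rightarrow> real) \<Rightarrow> 'a pmf"

definition policies :: "('s::finite, 'a::finite) mdp \<Rightarrow> ('s, 'a) policy set" where
  "policies M = {\<pi>. \<forall>h\<in>{1..horizon M}. \<forall>s a.
     (\<lambda>r. pmf (\<pi> h s r) a) \<in> borel_measurable reward_space}"

text \<open>A trajectory from step \<open>h\<close> on maps each \<open>t \<in> {h..H}\<close> to the triple of the state, the observed
  reward vector and the chosen action at step \<open>t\<close>.\<close>

definition step_space :: "('s \<times> ('a \<Rightarrow> real) \<times> 'a) measure" where
  "step_space = count_space UNIV \<Otimes>\<^sub>M (reward_space \<Otimes>\<^sub>M count_space UNIV)"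

text \<open>The conditional law of the trajectory given \<open>s\<^sub>h = s\<close>, by sequential sampling: the reward
  vector, then the action given the state and the rewards, then the next state given the state and
  the action only. Past the horizon the trajectory is empty.\<close>

function trajectory ::
  "('s::finite, 'a::finite) mdp \<Rightarrow> ('s, 'a) policy \<Rightarrow> nat \<Rightarrow> 's
     \<Rightarrow> (nat \<Rightarrow> 's \<times> ('a \<Rightarrow> real) \<times> 'a) measure" where
  "trajectory M \<pi> h s =
     (if h > horizon M then return (PiM {} (\<lambda>_. step_space)) (\<lambda>_. undefined)
      else rewards M h s \<bind> (\<lambda>r.
           measure_pmf (\<pi> h s r) \<bind> (\<lambda>a.
           measure_pmf (transition M h s a) \<bind> (\<lambda>s'.
           trajectory M \<pi> (Suc h) s' \<bind> (\<lambda>\<omega>.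
           return (PiM {h..horizon M} (\<lambda>_. step_space)) (fun_upd \<omega> h (s, r, a)))))))"
  by pat_completeness auto
termination
  by (relation "Wellfounded.measure (\<lambda>(M, \<pi>, h, s). Suc (horizon M) - h)") auto

declare trajectory.simps [simp del]

definition policy_value ::
  "('s::finite, 'a::finite) mdp \<Rightarrow> ('s, 'a) policy \<Rightarrow> nat \<Rightarrow> 's \<Rightarrow> real" where
  "policy_value M \<pi> h s =
     (LINT \<omega>|trajectory M \<pi> h s.
        (\<Sum>t\<in>{h..horizon M}. case \<omega> t of (s\<^sub>t, r\<^sub>t, a\<^sub>t) \<Rightarrow> r\<^sub>t a\<^sub>t))"

definition optimal_value :: "('s::finite, 'a::finite) mdp \<Rightarrow> nat \<Rightarrow> 's \<Rightarrow> real" where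
  "optimal_value M h s = (SUP \<pi>\<in>policies M. policy_value M \<pi> h s)"

definition optimal_policy :: "('s::finite, 'a::finite) mdp \<Rightarrow> ('s, 'a) policy \<Rightarrow> bool" where
  "optimal_policy M \<pi> \<longleftrightarrow> \<pi> \<in> policies M \<and>
     (\<forall>h\<in>{1..horizon M}. \<forall>s. policy_value M \<pi> h s = optimal_value M h s)"

definition deterministic ::
  "(nat \<Rightarrow> 's \<Rightarrow> ('a \<Rightarrow> real) \<Rightarrow> 'a) \<Rightarrow> ('s, 'a) policy" where
  "deterministic d = (\<lambda>h s r. return_pmf (d h s r))"

definition greedy ::
  "('s::finite, 'a::finite) mdp \<Rightarrow> (nat \<Rightarrow> 's \<Rightarrow> ('a \<Rightarrow> real) \<Rightarrow> 'a) \<Rightarrow> bool" where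
  "greedy M d \<longleftrightarrow> (\<forall>h\<in>{1..horizon M}. \<forall>s. \<forall>r\<in>space reward_space.
     is_arg_max
       (\<lambda>a. r a + (\<Sum>s'\<in>UNIV. pmf (transition M h s a) s' * optimal_value M (Suc h) s'))
       (\<lambda>_. True) (d h s r))"

end

theory Submission
  imports Defs
begin

text \<open>Integrating the return against the sequentially sampled trajectory law yields the evaluation
  recursion \<open>V\<^sub>h(s) = E[\<Sum>a. \<pi>(a) (R(a) + \<Sum>s'. P(s') V\<^sub>h\<^sub>+\<^sub>1(s'))]\<close>. Greediness refers only to the numbers
  \<open>optimal_value M (Suc h)\<close>, so a measurable greedy policy exists before anything is known about them:
  take the first maximiser in a fixed enumeration of the actions. Backward induction on \<open>h\<close> then shows
  that every greedy policy dominates all others: an average over actions is at most the maximum, which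
  the greedy action attains. Hence its value is the supremum, and its evaluation recursion is
  the Bellman equation.\<close>

section \<open>Measurability and boundedness of rewards and returns\<close>

abbreviation trajectory_space :: "nat \<Rightarrow> nat \<Rightarrow> (nat \<Rightarrow> 's \<times> ('a \<Rightarrow> real) \<times> 'a) measure" where
  "trajectory_space h H \<equiv> PiM {h..H} (\<lambda>_. step_space)"

definition collected :: "nat \<Rightarrow> nat \<Rightarrow> (nat \<Rightarrow> 's \<times> ('a \<Rightarrow> real) \<times> 'a) \<Rightarrow> real" where
  "collected h H \<omega> = (\<Sum>t\<in>{h..H}. case \<omega> t of (s, r, a) \<Rightarrow> r a)"

text \<open>The general rule for integrating against a bind needs a bound on the kernel masses. For
  a probability kernel this bound is 1, so only the bounded measurable integrand has to be
  supplied.\<close>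

lemma integral_bind_prob_algebra:
  fixes f :: "'b \<Rightarrow> real"
  assumes f: "f \<in> borel_measurable K" "\<And>x. x \<in> space K \<Longrightarrow> \<bar>f x\<bar> \<le> B"
    and N: "N \<in> M \<rightarrow>\<^sub>M prob_algebra K" and M: "prob_space M"
  shows "(LINT x|(M \<bind> N). f x) = (LINT x|M. LINT y|N x. f y)"
proof -
  interpret prob_space M by fact
  have "emeasure (N x) (space (N x)) = 1" if "x \<in> space M" for x
    using measurable_space[OF N that] by (auto simp: space_prob_algebra prob_space.emeasure_space_1)
  then show ?thesis
    by (intro integral_bind[where B = B and B' = 1 and K = K] f measurable_prob_algebraD[OF N]
        finite_measure_axioms AE_I2) auto
qed

lemma measurable_reward_component [measurable]:
  "(\<lambda>r. r a) \<in> borel_measurable (reward_space :: ('a::finite \<Rightarrow> real) measure)"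
  unfolding reward_space_def
  by (rule measurable_compose[OF measurable_component_singleton[OF UNIV_I]])
     (simp add: measurable_restrict_space1)

lemma reward_bounds:
  assumes "r \<in> space reward_space"
  shows "0 \<le> r a" "r a \<le> 1"
  using assms by (auto simp: reward_space_def space_PiM space_restrict_space PiE_iff)

lemma episodic_mdpD:
  assumes "episodic_mdp M" "h \<in> {1..horizon M}"
  shows "prob_space (rewards M h s)" "sets (rewards M h s) = sets reward_space"
    "space (rewards M h s) = space reward_space"
proof -
  show "prob_space (rewards M h s)" and sets: "sets (rewards M h s) = sets reward_space"
    using assms by (auto simp: episodic_mdp_def space_prob_algebra)
  show "space (rewards M h s) = space reward_space"
    by (rule sets_eq_imp_space_eq[OF sets])
qed

text \<open>The coordinate that is read off is itself random. As there are only countably many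
  actions, the evaluation is glued together from the measurable maps for each fixed action.\<close>

lemma measurable_step_reward [measurable]:
  "(\<lambda>(s, r, a). r a) \<in> borel_measurable (step_space :: ('s \<times> ('a::finite \<Rightarrow> real) \<times> 'a) measure)"
  unfolding step_space_def split_beta'
  by (rule measurable_compose_countable[where g = "\<lambda>x. snd (snd x)" and f = "\<lambda>a x. fst (snd x) a"])
     measurable

lemma measurable_collected [measurable]:
  "collected h H \<in> borel_measurable
     (trajectory_space h H :: (nat \<Rightarrow> 's \<times> ('a::finite \<Rightarrow> real) \<times> 'a) measure)"
  unfolding collected_def by measurable

text \<open>Each reward lies in \<open>[0,1]\<close>. The bound provides the integrability needed to
  integrate step by step.\<close>

lemma collected_bounded:
  assumes "\<omega> \<in> space (trajectory_space h H)"
  shows "\<bar>collected h H \<omega>\<bar> \<le> real (card {h..H})"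
proof -
  have "\<bar>case \<omega> t of (s, r, a) \<Rightarrow> r a\<bar> \<le> 1" if "t \<in> {h..H}" for t
  proof -
    obtain s r a where \<omega>: "\<omega> t = (s, r, a)" by (metis prod_cases3)
    have "\<omega> t \<in> space step_space"
      using assms that by (auto simp: space_PiM PiE_iff)
    then have "r \<in> space reward_space"
      by (simp add: \<omega> step_space_def space_pair_measure)
    then show ?thesis
      using reward_bounds[of r a] by (simp add: \<omega>)
  qed
  then have "\<bar>collected h H \<omega>\<bar> \<le> (\<Sum>t\<in>{h..H}. 1)"
    unfolding collected_def by (intro order_trans[OF sum_abs] sum_mono)
  then show ?thesis by simp
qed

lemma collected_fun_upd:
  assumes "h \<le> H"
  shows "collected h H (fun_upd \<omega> h (s, r, a)) = r a + collected (Suc h) H \<omega>"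
proof -
  have "{h..H} = insert h {Suc h..H}" using assms by auto
  then show ?thesis by (auto simp: collected_def intro!: sum.cong)
qed

text \<open>On a finite type the mass of an event is a finite sum of point masses. Hence the
  pointwise measurability demanded by \<open>policies\<close> is enough for a policy to be a
  probability kernel.\<close>

lemma measurable_measure_pmf_kernel:
  fixes p :: "'b \<Rightarrow> 'a::finite pmf"
  assumes "\<And>a. (\<lambda>r. pmf (p r) a) \<in> borel_measurable N"
  shows "(\<lambda>r. measure_pmf (p r)) \<in> N \<rightarrow>\<^sub>M prob_algebra (count_space UNIV)"
proof (intro measurable_prob_algebraI measurable_subprob_algebra)
  fix A :: "'a set"
  note assms[measurable]
  show "(\<lambda>r. emeasure (measure_pmf (p r)) A) \<in> borel_measurable N"
    by (simp add: emeasure_measure_pmf_finite)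
qed (auto intro: measure_pmf.prob_space_axioms prob_space_imp_subprob_space)

text \<open>Measurability holds jointly in the rewards, the action and the tail of the trajectory.
  Sections in the tail alone would not make the later binds measurable in the observed
  rewards.\<close>

lemma measurable_trajectory_update:
  assumes "h \<le> H"
  shows "(\<lambda>x. fun_upd (snd x) h (s, fst x)) \<in>
    (reward_space \<Otimes>\<^sub>M count_space UNIV) \<Otimes>\<^sub>M trajectory_space (Suc h) H \<rightarrow>\<^sub>M
    (trajectory_space h H :: (nat \<Rightarrow> 's \<times> ('a::finite \<Rightarrow> real) \<times> 'a) measure)"
proof -
  have "{h..H} = {Suc h..H} \<union> {h}" using assms by auto
  then show ?thesis
    by (rule measurable_fun_upd) (simp_all add: step_space_def)
qed

section \<open>One step of sequential sampling\<close>

text \<open>One unfolding of \<open>trajectory\<close>, with an arbitrary family \<open>J\<close> of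
  probability laws for the continuation. This separates the measure theory of a single step from the
  recursion over steps.\<close>

locale episode_step =
  fixes h H :: nat and s :: "'s::finite"
    and R :: "('a::finite \<Rightarrow> real) measure"
    and p :: "('a \<Rightarrow> real) \<Rightarrow> 'a pmf"
    and P :: "'a \<Rightarrow> 's pmf"
    and J :: "'s \<Rightarrow> (nat \<Rightarrow> 's \<times> ('a \<Rightarrow> real) \<times> 'a) measure"
  assumes h_le: "h \<le> H"
    and R: "R \<in> space (prob_algebra reward_space)"
    and p: "\<And>a. (\<lambda>r. pmf (p r) a) \<in> borel_measurable reward_space"
    and J: "\<And>s'. J s' \<in> space (prob_algebra (trajectory_space (Suc h) H))"
begin

text \<open>This and the next two definitions are the nested binds of \<open>trajectory\<close>,
  innermost first. Each is a function of its last argument, so that it can serve as the kernel of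
  the bind around it.\<close>

definition update_law where
  "update_law r a = (\<lambda>s'. J s' \<bind> (\<lambda>\<omega>. return (trajectory_space h H) (fun_upd \<omega> h (s, r, a))))"

definition transition_law where
  "transition_law r = (\<lambda>a. measure_pmf (P a) \<bind> update_law r a)"

definition action_law where
  "action_law = (\<lambda>r. measure_pmf (p r) \<bind> transition_law r)"

lemma measurable_update:
  fixes r :: "'a \<Rightarrow> real"
  assumes "r \<in> space reward_space"
  shows "(\<lambda>\<omega>. fun_upd \<omega> h (s, r, a)) \<in> trajectory_space (Suc h) H \<rightarrow>\<^sub>M trajectory_space h H"
proof -
  have "(r, a) \<in> space (reward_space \<Otimes>\<^sub>M count_space UNIV)"
    using assms by (simp add: space_pair_measure)
  from measurable_compose[OF measurable_Pair1'[OF this] measurable_trajectory_update[OF h_le, of s]]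
  show ?thesis by simp
qed

text \<open>Sampling a point and returning its image is a pushforward, which turns the innermost
  integral into a change of variables.\<close>

lemma update_law_eq_distr:
  assumes "r \<in> space reward_space"
  shows "update_law r a s' = distr (J s') (trajectory_space h H) (\<lambda>\<omega>. fun_upd \<omega> h (s, r, a))"
proof -
  have sets: "sets (J s') = sets (trajectory_space (Suc h) H)" and "prob_space (J s')"
    using J[of s'] by (auto simp: space_prob_algebra)
  then have "space (J s') \<noteq> {}"
    using prob_space.not_empty by blast
  then show ?thesis
    unfolding update_law_def
    using bind_return_distr'[of "J s'" "\<lambda>\<omega>. fun_upd \<omega> h (s, r, a)" "trajectory_space h H"]
      measurable_update[OF assms] sets
    by (simp add: measurable_cong_sets[OF sets refl])
qed

text \<open>Both outer layers bind over one coordinate while the others stay as parameters, so the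
  kernel is needed jointly in rewards, action and next state.\<close>

lemma measurable_update_law:
  "(\<lambda>((r, a), s'). update_law r a s') \<in>
     (reward_space \<Otimes>\<^sub>M count_space UNIV) \<Otimes>\<^sub>M count_space UNIV \<rightarrow>\<^sub>M
     prob_algebra (trajectory_space h H)"
proof -
  let ?N = "(reward_space \<Otimes>\<^sub>M count_space UNIV) \<Otimes>\<^sub>M count_space UNIV
    :: ((('a \<Rightarrow> real) \<times> 'a) \<times> 's) measure"
  have [measurable]: "J \<in> count_space UNIV \<rightarrow>\<^sub>M prob_algebra (trajectory_space (Suc h) H)"
    using J by (simp add: measurable_count_space_eq1)
  have "(\<lambda>x. J (snd x) \<bind> (\<lambda>\<omega>. return (trajectory_space h H) (fun_upd \<omega> h (s, fst x)))) \<in>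
    ?N \<rightarrow>\<^sub>M prob_algebra (trajectory_space h H)"
  proof (rule measurable_bind_prob_space2)
    show "(\<lambda>x. J (snd x)) \<in> ?N \<rightarrow>\<^sub>M prob_algebra (trajectory_space (Suc h) H)"
      by measurable
    have "(\<lambda>z. (fst (fst z), snd z)) \<in> ?N \<Otimes>\<^sub>M trajectory_space (Suc h) H \<rightarrow>\<^sub>M
        (reward_space \<Otimes>\<^sub>M count_space UNIV) \<Otimes>\<^sub>M trajectory_space (Suc h) H"
      by measurable
    from measurable_compose[OF this measurable_trajectory_update[OF h_le, of s]]
    have "(\<lambda>z. fun_upd (snd z) h (s, fst (fst z))) \<in>
      ?N \<Otimes>\<^sub>M trajectory_space (Suc h) H \<rightarrow>\<^sub>M trajectory_space h H"
      by simp
    then show "(\<lambda>(x, \<omega>). return (trajectory_space h H) (fun_upd \<omega> h (s, fst x))) \<in>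
      ?N \<Otimes>\<^sub>M trajectory_space (Suc h) H \<rightarrow>\<^sub>M prob_algebra (trajectory_space h H)"
      unfolding split_beta' by (rule measurable_compose) (rule measurable_return_prob_space)
  qed
  then show ?thesis
    by (simp add: update_law_def split_beta')
qed

lemma measurable_transition_law:
  "(\<lambda>(r, a). transition_law r a) \<in>
     reward_space \<Otimes>\<^sub>M count_space UNIV \<rightarrow>\<^sub>M prob_algebra (trajectory_space h H)"
proof -
  have "(\<lambda>a. measure_pmf (P a)) \<in> count_space UNIV \<rightarrow>\<^sub>M prob_algebra (count_space UNIV)"
    by (auto simp: measurable_count_space_eq1 space_prob_algebra measure_pmf.prob_space_axioms)
  then have "(\<lambda>x. measure_pmf (P (snd x)))
    \<in> reward_space \<Otimes>\<^sub>M count_space UNIV \<rightarrow>\<^sub>M prob_algebra (count_space UNIV)"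
    by measurable
  from measurable_bind_prob_space2[OF this, of "\<lambda>x. update_law (fst x) (snd x)"]
    measurable_update_law
  show ?thesis
    by (simp add: transition_law_def split_beta')
qed

lemma measurable_action_law:
  "action_law \<in> reward_space \<rightarrow>\<^sub>M prob_algebra (trajectory_space h H)"
  unfolding action_law_def
  by (rule measurable_bind_prob_space2[OF measurable_measure_pmf_kernel[OF p]
        measurable_transition_law])

text \<open>The source is discrete, so it suffices that all values are probability laws, and joint
  measurability provides this.\<close>

lemma measurable_update_law_state:
  assumes "r \<in> space reward_space"
  shows "update_law r a \<in> measure_pmf q \<rightarrow>\<^sub>M prob_algebra (trajectory_space h H)"
  using measurable_space[OF measurable_update_law, of "((r, a), _)"] assms
  by (auto simp: space_pair_measure)

lemma measurable_transition_law_action: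
  assumes "r \<in> space reward_space"
  shows "transition_law r \<in> measure_pmf q \<rightarrow>\<^sub>M prob_algebra (trajectory_space h H)"
  using measurable_space[OF measurable_transition_law, of "(r, _)"] assms
  by (auto simp: space_pair_measure)

lemma R_facts: "prob_space R" "sets R = sets reward_space" "space R = space reward_space"
  using R by (auto simp: space_prob_algebra dest: sets_eq_imp_space_eq)

lemma bind_action_law_in_prob_algebra:
  "R \<bind> action_law \<in> space (prob_algebra (trajectory_space h H))"
  using measurable_space[OF measurable_bind_prob_space[OF measurable_ident measurable_action_law] R]
  by simp

text \<open>The immediate reward is constant under \<open>J s'\<close>, a law of mass 1, and the
  updated entry leaves the later steps untouched.\<close>

lemma integral_update_law:
  assumes "r \<in> space reward_space"
  shows "(LINT \<omega>|update_law r a s'. collected h H \<omega>) = r a + (LINT \<omega>|J s'. collected (Suc h) H \<omega>)"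
proof -
  have sets: "sets (J s') = sets (trajectory_space (Suc h) H)" and "prob_space (J s')"
    using J[of s'] by (auto simp: space_prob_algebra)
  interpret J: prob_space "J s'" by fact
  have "integrable (J s') (collected (Suc h) H)"
    using collected_bounded[of _ "Suc h" H] sets_eq_imp_space_eq[OF sets]
    by (intro J.integrable_const_bound[where B = "real (card {Suc h..H})"])
       (auto simp: measurable_cong_sets[OF sets refl])
  then show ?thesis
    using measurable_update[OF assms]
    by (simp add: update_law_eq_distr[OF assms] integral_distr collected_fun_upd[OF h_le]
        measurable_cong_sets[OF sets refl] J.prob_space)
qed

lemma integral_transition_law:
  assumes "r \<in> space reward_space"
  shows "(LINT \<omega>|transition_law r a. collected h H \<omega>) =
    r a + (\<Sum>s'\<in>UNIV. pmf (P a) s' * (LINT \<omega>|J s'. collected (Suc h) H \<omega>))"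
proof -
  have "(LINT \<omega>|transition_law r a. collected h H \<omega>) =
    (LINT s'|P a. LINT \<omega>|update_law r a s'. collected h H \<omega>)"
    unfolding transition_law_def
    by (rule integral_bind_prob_algebra[OF measurable_collected collected_bounded
          measurable_update_law_state[OF assms] measure_pmf.prob_space_axioms])
  also have "\<dots> = (\<Sum>s'\<in>UNIV. pmf (P a) s' * (r a + (LINT \<omega>|J s'. collected (Suc h) H \<omega>)))"
    by (simp add: integral_measure_pmf[of UNIV] integral_update_law[OF assms])
  finally show ?thesis
    by (simp add: distrib_left sum.distrib sum_pmf_eq_1 flip: sum_distrib_right)
qed

lemma integral_action_law:
  assumes "r \<in> space reward_space"
  shows "(LINT \<omega>|action_law r. collected h H \<omega>) =
    (\<Sum>a\<in>UNIV. pmf (p r) a *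
      (r a + (\<Sum>s'\<in>UNIV. pmf (P a) s' * (LINT \<omega>|J s'. collected (Suc h) H \<omega>))))"
proof -
  have "(LINT \<omega>|action_law r. collected h H \<omega>) =
    (LINT a|p r. LINT \<omega>|transition_law r a. collected h H \<omega>)"
    unfolding action_law_def
    by (rule integral_bind_prob_algebra[OF measurable_collected collected_bounded
          measurable_transition_law_action[OF assms] measure_pmf.prob_space_axioms])
  then show ?thesis
    by (simp add: integral_measure_pmf[of UNIV] integral_transition_law[OF assms])
qed

lemma integral_bind_action_law:
  "(LINT \<omega>|(R \<bind> action_law). collected h H \<omega>) =
    (LINT r|R. (\<Sum>a\<in>UNIV. pmf (p r) a *
      (r a + (\<Sum>s'\<in>UNIV. pmf (P a) s' * (LINT \<omega>|J s'. collected (Suc h) H \<omega>)))))"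
proof -
  have "(LINT \<omega>|(R \<bind> action_law). collected h H \<omega>) =
      (LINT r|R. LINT \<omega>|action_law r. collected h H \<omega>)"
    using measurable_action_law
    by (intro integral_bind_prob_algebra[OF measurable_collected collected_bounded] R_facts)
       (auto simp: measurable_cong_sets[OF R_facts(2) refl])
  also have "\<dots> = (LINT r|R. (\<Sum>a\<in>UNIV. pmf (p r) a *
      (r a + (\<Sum>s'\<in>UNIV. pmf (P a) s' * (LINT \<omega>|J s'. collected (Suc h) H \<omega>)))))"
    by (intro Bochner_Integration.integral_cong refl integral_action_law) (simp add: R_facts)
  finally show ?thesis .
qed

end

section \<open>Trajectory laws and the evaluation recursion\<close>

text \<open>That the continuations are probability laws stays a hypothesis here, because the
  induction in \<open>trajectory_in_prob_algebra\<close> has to supply it.\<close>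

lemma trajectory_eq_bind:
  assumes "episodic_mdp M" "\<pi> \<in> policies M" "h \<in> {1..horizon M}"
    and J: "\<And>s'. trajectory M \<pi> (Suc h) s'
              \<in> space (prob_algebra (trajectory_space (Suc h) (horizon M)))"
  shows "episode_step h (horizon M) (rewards M h s) (\<pi> h s) (trajectory M \<pi> (Suc h))"
    and "trajectory M \<pi> h s = rewards M h s \<bind>
      episode_step.action_law h (horizon M) s (\<pi> h s) (transition M h s) (trajectory M \<pi> (Suc h))"
proof -
  show step: "episode_step h (horizon M) (rewards M h s) (\<pi> h s) (trajectory M \<pi> (Suc h))"
    using assms by unfold_locales (auto simp: episodic_mdp_def policies_def)
  show "trajectory M \<pi> h s = rewards M h s \<bind>
      episode_step.action_law h (horizon M) s (\<pi> h s) (transition M h s) (trajectory M \<pi> (Suc h))"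
    using assms(3)
    by (subst trajectory.simps)
       (simp add: episode_step.action_law_def[OF step] episode_step.transition_law_def[OF step]
         episode_step.update_law_def[OF step])
qed

lemma trajectory_past_horizon:
  "trajectory M \<pi> (Suc (horizon M)) s = return (PiM {} (\<lambda>_. step_space)) (\<lambda>_. undefined)"
  by (simp add: trajectory.simps)

lemma trajectory_in_prob_algebra:
  assumes "episodic_mdp M" "\<pi> \<in> policies M" "1 \<le> h" "h \<le> Suc (horizon M)"
  shows "trajectory M \<pi> h s \<in> space (prob_algebra (trajectory_space h (horizon M)))"
  using assms(4,3)
proof (induction h arbitrary: s rule: inc_induct)
  case base
  \<comment> \<open>The index set is empty past the horizon, so the constant function
    \<open>undefined\<close> is the only point of the product space.\<close>
  show ?case
    by (auto simp: trajectory_past_horizon space_prob_algebra space_PiM intro!: prob_space_return)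
next
  case (step h)
  then have h: "h \<in> {1..horizon M}" by simp
  have J: "trajectory M \<pi> (Suc h) s' \<in> space (prob_algebra (trajectory_space (Suc h) (horizon M)))"
    for s' using step by simp
  show ?case
    unfolding trajectory_eq_bind(2)[OF assms(1,2) h J]
    by (rule episode_step.bind_action_law_in_prob_algebra[OF trajectory_eq_bind(1)[OF assms(1,2) h J]])
qed

lemma policy_value_eq_collected:
  "policy_value M \<pi> h s = (LINT \<omega>|trajectory M \<pi> h s. collected h (horizon M) \<omega>)"
  by (simp add: policy_value_def collected_def)

text \<open>The Q-function for an arbitrary continuation value \<open>v\<close>. It is used both
  with the value of a policy and with the optimal value.\<close>

definition action_value ::
  "('s::finite, 'a::finite) mdp \<Rightarrow> nat \<Rightarrow> 's \<Rightarrow> ('s \<Rightarrow> real) \<Rightarrow> ('a \<Rightarrow> real) \<Rightarrow> 'a \<Rightarrow> real" where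
  "action_value M h s v r a = r a + (\<Sum>s'\<in>UNIV. pmf (transition M h s a) s' * v s')"

lemma policy_value_Suc_horizon: "policy_value M \<pi> (Suc (horizon M)) s = 0"
  by (simp add: policy_value_def)

lemma policy_value_rec:
  assumes "episodic_mdp M" "\<pi> \<in> policies M" and h: "h \<in> {1..horizon M}"
  shows "policy_value M \<pi> h s =
    (LINT r|rewards M h s. (\<Sum>a\<in>UNIV. pmf (\<pi> h s r) a *
      action_value M h s (policy_value M \<pi> (Suc h)) r a))"
proof -
  have J: "trajectory M \<pi> (Suc h) s' \<in> space (prob_algebra (trajectory_space (Suc h) (horizon M)))"
    for s' using h by (intro trajectory_in_prob_algebra assms) auto
  show ?thesis
    unfolding policy_value_eq_collected action_value_def trajectory_eq_bind(2)[OF assms J, of s]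
    by (rule episode_step.integral_bind_action_law[OF trajectory_eq_bind(1)[OF assms J]])
qed

lemma measurable_action_value [measurable]:
  "(\<lambda>r. action_value M h s v r a) \<in> borel_measurable reward_space"
  unfolding action_value_def by measurable

lemma action_value_bounded:
  assumes "r \<in> space reward_space"
  shows "\<bar>action_value M h s v r a\<bar> \<le> 1 + (\<Sum>s'\<in>UNIV. \<bar>v s'\<bar>)"
proof -
  have "\<bar>\<Sum>s'\<in>UNIV. pmf (transition M h s a) s' * v s'\<bar> \<le> (\<Sum>s'\<in>UNIV. \<bar>v s'\<bar>)"
    by (intro order_trans[OF sum_abs] sum_mono)
       (simp add: abs_mult pmf_le_1 mult_left_le_one_le)
  then show ?thesis
    using reward_bounds[OF assms, of a] by (simp add: action_value_def)
qed

text \<open>Monotonicity of the Bochner integral requires integrability on both sides when two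
  policies are compared.\<close>

lemma integrable_expected_action_value:
  assumes "episodic_mdp M" "\<pi> \<in> policies M" "h \<in> {1..horizon M}"
  shows "integrable (rewards M h s) (\<lambda>r. \<Sum>a\<in>UNIV. pmf (\<pi> h s r) a * action_value M h s v r a)"
proof -
  note R = episodic_mdpD[OF assms(1,3)]
  interpret prob_space "rewards M h s" by (rule R)
  have [measurable]: "(\<lambda>r. pmf (\<pi> h s r) a) \<in> borel_measurable reward_space" for a
    using assms by (auto simp: policies_def)
  have int: "integrable (rewards M h s) (\<lambda>r. pmf (\<pi> h s r) a * action_value M h s v r a)" for a
  proof (rule integrable_const_bound)
    show "AE r in rewards M h s.
        norm (pmf (\<pi> h s r) a * action_value M h s v r a) \<le> 1 + (\<Sum>s'\<in>UNIV. \<bar>v s'\<bar>)"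
      using action_value_bounded[of _ M h s v a] R(3)
      by (auto intro!: AE_I2 simp: abs_mult pmf_le_1
          intro: order_trans[OF mult_left_le_one_le])
  qed (simp add: measurable_cong_sets[OF R(2) refl])
  then show ?thesis by simp
qed

section \<open>Measurable selection of a greedy action\<close>

text \<open>The weights sum to 1. This is why randomised policies gain nothing.\<close>

lemma expected_le_Max:
  fixes f :: "'a::finite \<Rightarrow> real"
  shows "(\<Sum>a\<in>UNIV. pmf p a * f a) \<le> (MAX a\<in>UNIV. f a)"
proof -
  have "(\<Sum>a\<in>UNIV. pmf p a * f a) \<le> (\<Sum>a\<in>UNIV. pmf p a * (MAX a\<in>UNIV. f a))"
    by (intro sum_mono mult_left_mono) auto
  then show ?thesis
    by (simp add: sum_pmf_eq_1 flip: sum_distrib_right)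
qed

lemma expected_return_pmf:
  fixes f :: "'a::finite \<Rightarrow> real"
  shows "(\<Sum>a\<in>UNIV. pmf (return_pmf b) a * f a) = f b"
  using integral_measure_pmf[of UNIV "return_pmf b" f] by simp

lemma is_arg_max_imp_eq_Max:
  fixes f :: "'a::finite \<Rightarrow> real"
  assumes "is_arg_max f (\<lambda>_. True) b"
  shows "f b = (MAX a\<in>UNIV. f a)"
  using assms by (intro Max_eqI[symmetric]) (auto simp: is_arg_max_def not_less)

text \<open>Ties are broken by a fixed enumeration of the actions: the index of the first maximiser
  depends measurably on the rewards, and decoding an index is a map on a discrete space.\<close>

lemma greedy_exists:
  fixes M :: "('s::finite, 'a::finite) mdp"
  shows "\<exists>d. deterministic d \<in> policies M \<and> greedy M d"
proof -
  define Q where "Q h s r = action_value M h s (optimal_value M (Suc h)) r" for h s r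
  define best where "best h s r n \<longleftrightarrow> (\<forall>b. Q h s r b \<le> Q h s r (from_nat n))" for h s r n
  define d :: "nat \<Rightarrow> 's \<Rightarrow> ('a \<Rightarrow> real) \<Rightarrow> 'a" where
    "d h s r = from_nat (LEAST n. best h s r n)" for h s r
  have "best h s r (LEAST n. best h s r n)" for h s r
  proof -
    \<comment> \<open>Finiteness of the action type yields a maximiser, so the \<open>LEAST\<close>
      ranges over a nonempty set of indices.\<close>
    obtain a where "Q h s r a = Max (range (Q h s r))"
      using Max_in[of "range (Q h s r)"] by (auto simp del: Max_in)
    then have "best h s r (to_nat a)"
      by (auto simp: best_def)
    then show ?thesis by (rule LeastI)
  qed
  then have "greedy M d"
    by (simp add: greedy_def is_arg_max_def not_less best_def d_def Q_def action_value_def)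
  moreover have "deterministic d \<in> policies M"
  proof -
    have Q: "(\<lambda>r. Q h s r b) \<in> borel_measurable reward_space" for h s b
      unfolding Q_def by measurable
    \<comment> \<open>Being a best index is a countable conjunction of comparisons between
      measurable functions.\<close>
    have [measurable]: "Measurable.pred reward_space (\<lambda>r. best h s r n)" for h s n
      unfolding best_def
      by (intro pred_intros_countable) (simp add: pred_def borel_measurable_le[OF Q Q])
    have "(\<lambda>r. pmf (return_pmf (from_nat (LEAST n. best h s r n))) a)
      \<in> borel_measurable reward_space" for h s and a :: 'a
      by (rule measurable_compose[where N = "count_space UNIV"
            and g = "\<lambda>n. pmf (return_pmf (from_nat n)) a"]) measurable
    then show ?thesis
      by (simp add: policies_def deterministic_def d_def)
  qed
  ultimately show ?thesis by blast
qed

section \<open>Optimality of greedy policies and the Bellman equation\<close>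

text \<open>For a deterministic policy the sum in the evaluation recursion collapses to the term of
  the chosen action, which greediness makes the maximum.\<close>

lemma greedy_value:
  assumes M: "episodic_mdp M" and d: "deterministic d \<in> policies M" "greedy M d"
    and h: "h \<in> {1..horizon M}"
    and next_value: "policy_value M (deterministic d) (Suc h) = optimal_value M (Suc h)"
  shows "policy_value M (deterministic d) h s =
    (LINT r|rewards M h s. (MAX a\<in>UNIV. action_value M h s (optimal_value M (Suc h)) r a))"
proof -
  note space = episodic_mdpD(3)[OF M h]
  show ?thesis
    unfolding policy_value_rec[OF M d(1) h] next_value
  proof (intro Bochner_Integration.integral_cong refl)
    fix r assume "r \<in> space (rewards M h s)"
    then have "is_arg_max (action_value M h s (optimal_value M (Suc h)) r) (\<lambda>_. True) (d h s r)"
      using d(2) h unfolding greedy_def action_value_def space by blast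
    then show "(\<Sum>a\<in>UNIV. pmf (deterministic d h s r) a *
        action_value M h s (optimal_value M (Suc h)) r a) =
      (MAX a\<in>UNIV. action_value M h s (optimal_value M (Suc h)) r a)"
      by (simp add: deterministic_def expected_return_pmf is_arg_max_imp_eq_Max)
  qed
qed

text \<open>Two inequalities are chained under the integral: replacing the continuation of \<pi> by
  the optimal value raises each term, and the average over actions is at most the maximum.\<close>

lemma policy_value_le_greedy_value:
  assumes M: "episodic_mdp M" and d: "deterministic d \<in> policies M" "greedy M d"
    and \<pi>: "\<pi> \<in> policies M" and h: "h \<in> {1..horizon M}"
    and next_value: "policy_value M (deterministic d) (Suc h) = optimal_value M (Suc h)"
      "\<And>s. policy_value M \<pi> (Suc h) s \<le> optimal_value M (Suc h) s"
  shows "policy_value M \<pi> h s \<le> policy_value M (deterministic d) h s"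
proof -
  note space = episodic_mdpD(3)[OF M h]
  let ?Q = "action_value M h s (optimal_value M (Suc h))"
  show ?thesis
    unfolding policy_value_rec[OF M \<pi> h] policy_value_rec[OF M d(1) h] next_value(1)
  proof (intro integral_mono integrable_expected_action_value M \<pi> d(1) h)
    fix r assume "r \<in> space (rewards M h s)"
    then have max: "is_arg_max (?Q r) (\<lambda>_. True) (d h s r)"
      using d(2) h unfolding greedy_def action_value_def space by blast
    have "(\<Sum>a\<in>UNIV. pmf (\<pi> h s r) a * action_value M h s (policy_value M \<pi> (Suc h)) r a)
      \<le> (\<Sum>a\<in>UNIV. pmf (\<pi> h s r) a * ?Q r a)"
      unfolding action_value_def
      by (intro sum_mono mult_left_mono add_left_mono next_value(2) pmf_nonneg)
    also have "\<dots> \<le> (MAX a\<in>UNIV. ?Q r a)"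
      by (rule expected_le_Max)
    also have "\<dots> = (\<Sum>a\<in>UNIV. pmf (deterministic d h s r) a * ?Q r a)"
      by (simp add: deterministic_def expected_return_pmf is_arg_max_imp_eq_Max[OF max])
    finally show "(\<Sum>a\<in>UNIV. pmf (\<pi> h s r) a * action_value M h s (policy_value M \<pi> (Suc h)) r a)
      \<le> (\<Sum>a\<in>UNIV. pmf (deterministic d h s r) a * ?Q r a)" .
  qed
qed

text \<open>Backward induction needs both claims at once: the equality turns greediness with respect
  to \<open>optimal_value\<close> into greediness with respect to the policy's own continuation, and
  the inequality bounds the continuation of the competitor.\<close>

lemma greedy_dominates:
  assumes M: "episodic_mdp M" and d: "deterministic d \<in> policies M" "greedy M d"
    and "1 \<le> h" "h \<le> Suc (horizon M)"
  shows "policy_value M (deterministic d) h s = optimal_value M h s \<and>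
    (\<forall>\<pi>\<in>policies M. policy_value M \<pi> h s \<le> optimal_value M h s)"
  using assms(5,4)
proof (induction h arbitrary: s rule: inc_induct)
  case base
  \<comment> \<open>Past the horizon all values are 0, but the supremum of this constant is 0 only
    over a nonempty set.\<close>
  have "policies M \<noteq> {}" using d(1) by blast
  then show ?case by (simp add: policy_value_Suc_horizon optimal_value_def)
next
  case (step h)
  have h: "h \<in> {1..horizon M}" using step by simp
  have le: "policy_value M \<pi> h s \<le> policy_value M (deterministic d) h s"
    if "\<pi> \<in> policies M" for \<pi>
    using step.IH that by (intro policy_value_le_greedy_value[OF M d that h]) auto
  \<comment> \<open>The greedy policy is itself a competitor, so the supremum is an attained maximum
    and no separate bound on the set of values is required.\<close>
  then have "optimal_value M h s = policy_value M (deterministic d) h s"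
    unfolding optimal_value_def by (intro cSup_eq_maximum) (use d(1) in auto)
  then show ?case using le by simp
qed

theorem proposition1:
  fixes M :: "('s::finite, 'a::finite) mdp"
  assumes "episodic_mdp M"
  shows
    (* the supremum defining the optimal value is a maximum *)
    "(\<forall>h\<in>{1..Suc (horizon M)}. \<forall>s.
        (\<exists>\<pi>\<in>policies M. policy_value M \<pi> h s = optimal_value M h s) \<and>
        (\<forall>\<pi>\<in>policies M. policy_value M \<pi> h s \<le> optimal_value M h s)) \<and>
     (\<forall>s. optimal_value M (Suc (horizon M)) s = 0) \<and>
     (\<forall>h\<in>{1..horizon M}. \<forall>s.
        optimal_value M h s =
          (LINT r|rewards M h s. (MAX a\<in>UNIV.
             r a + (\<Sum>s'\<in>UNIV. pmf (transition M h s a) s' * optimal_value M (Suc h) s')))) \<and>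
     (\<exists>d. deterministic d \<in> policies M \<and> greedy M d) \<and>
     (\<forall>d. deterministic d \<in> policies M \<and> greedy M d \<longrightarrow> optimal_policy M (deterministic d))"
proof (intro conjI)
  obtain d where d: "deterministic d \<in> policies M" "greedy M d"
    using greedy_exists by blast
  note opt = greedy_dominates[OF assms d]
  show "\<forall>h\<in>{1..Suc (horizon M)}. \<forall>s.
      (\<exists>\<pi>\<in>policies M. policy_value M \<pi> h s = optimal_value M h s) \<and>
      (\<forall>\<pi>\<in>policies M. policy_value M \<pi> h s \<le> optimal_value M h s)"
    using opt d(1) by (auto intro!: bexI[of _ "deterministic d"])
  show "\<forall>s. optimal_value M (Suc (horizon M)) s = 0"
    using opt[of "Suc (horizon M)"] by (simp add: policy_value_Suc_horizon)
  show "\<forall>h\<in>{1..horizon M}. \<forall>s. optimal_value M h s =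
      (LINT r|rewards M h s. (MAX a\<in>UNIV.
         r a + (\<Sum>s'\<in>UNIV. pmf (transition M h s a) s' * optimal_value M (Suc h) s')))"
  proof (intro ballI allI)
    fix h s assume h: "h \<in> {1..horizon M}"
    \<comment> \<open>At the last step \<open>Suc h\<close> lies just past the horizon, a case that
      \<open>greedy_dominates\<close> includes.\<close>
    then have "policy_value M (deterministic d) (Suc h) = optimal_value M (Suc h)"
      using opt[of "Suc h"] by auto
    from greedy_value[OF assms d h this, of s] opt[of h s] h
    show "optimal_value M h s =
      (LINT r|rewards M h s. (MAX a\<in>UNIV.
         r a + (\<Sum>s'\<in>UNIV. pmf (transition M h s a) s' * optimal_value M (Suc h) s')))"
      by (simp add: action_value_def)
  qed
  show "\<exists>d. deterministic d \<in> policies M \<and> greedy M d"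
    by (rule greedy_exists)
  show "\<forall>d. deterministic d \<in> policies M \<and> greedy M d \<longrightarrow> optimal_policy M (deterministic d)"
    \<comment> \<open>The domination result holds for every measurable greedy selection, so the way
      ties are broken does not matter.\<close>
    using greedy_dominates[OF assms] by (auto simp: optimal_policy_def)
qed

end
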